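(* Let $\sigma\in\{-1,0,1\}$ and let $\iota$ be a hypercomplex unit with $\iota^2=\sigma$. Let $\begin{pmatrix}a&b\\c&d\end{pmatrix}\in \mathrm{SL}_2(\mathbb{R})$ and $(u,v)\in\mathbb{R}^2$ with $v>0$ and $(cu+d)^2-\sigma(cv)^2\neq 0$. Then, with the identification of $(u,v)$ with $w=u+\iota v$, the map $$\begin{pmatrix}a&b\\c&d\end{pmatrix}:(u,v)\mapsto\left(\frac{(au+b)(cu+d)-\sigma cav^2}{(cu+d)^2-\sigma(cv)^2},\ \frac{v}{(cu+d)^2-\sigma(cv)^2}\right)$$ becomes the linear-fractional (Möbius) transformation $$\begin{pmatrix}a&b\\c&d\end{pmatrix}: w\mapsto\frac{aw+b}{cw+d},\qquad w=u+\iota v,$$ in all three cases $\sigma=-1,0,1$.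
   Context: For $\sigma=-1,0,1$ the hypercomplex numbers $u+\iota v$ ($u,v\in\mathbb{R}$, $\iota^2=\sigma$) form the two-dimensional commutative associative real algebra of complex, dual and double numbers respectively. The quotient $\frac{aw+b}{cw+d}$ means $(aw+b)(cw+d)^{-1}$ in this algebra. $\mathrm{SL}_2(\mathbb{R})$ is the group of real $2\times2$ matrices with determinant one. *)

theory Defs
  imports "HOL-Analysis.Determinants" "HOL-Algebra.RingHom"
begin

text \<open>
  Only the multiplication depends on the value of \<open>\<sigma>\<close>, so the algebra is a ring
  structure with parameter \<open>\<sigma>\<close> on one fixed type. Real scalars act through the
  embedding \<open>hyp_real\<close>.
\<close>

datatype hypercomplex = Hyp (hyp_re: real) (hyp_im: real)

definition hyp_ring :: "real \<Rightarrow> hypercomplex ring" where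
  "hyp_ring \<sigma> =
    \<lparr>carrier = UNIV,
     mult = (\<lambda>x y. Hyp (hyp_re x * hyp_re y + \<sigma> * (hyp_im x * hyp_im y))
                       (hyp_re x * hyp_im y + hyp_im x * hyp_re y)),
     one = Hyp 1 0,
     zero = Hyp 0 0,
     add = (\<lambda>x y. Hyp (hyp_re x + hyp_re y) (hyp_im x + hyp_im y))\<rparr>"

definition hyp_real :: "real \<Rightarrow> hypercomplex" where
  "hyp_real r = Hyp r 0"

definition hyp_unit :: hypercomplex where
  "hyp_unit = Hyp 0 1"

definition hyp_of_pair :: "real \<Rightarrow> real \<times> real \<Rightarrow> hypercomplex" where
  "hyp_of_pair \<sigma> = (\<lambda>(u, v).
     hyp_real u \<oplus>\<^bsub>hyp_ring \<sigma>\<^esub> (hyp_unit \<otimes>\<^bsub>hyp_ring \<sigma>\<^esub> hyp_real v))"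

definition SL2 :: "(real ^ 2 ^ 2) set" where
  "SL2 = {A. det A = 1}"

definition moebius_num :: "real \<Rightarrow> real ^ 2 ^ 2 \<Rightarrow> hypercomplex \<Rightarrow> hypercomplex" where
  "moebius_num \<sigma> A w =
     (hyp_real (A $ 1 $ 1) \<otimes>\<^bsub>hyp_ring \<sigma>\<^esub> w) \<oplus>\<^bsub>hyp_ring \<sigma>\<^esub> hyp_real (A $ 1 $ 2)"

definition moebius_den :: "real \<Rightarrow> real ^ 2 ^ 2 \<Rightarrow> hypercomplex \<Rightarrow> hypercomplex" where
  "moebius_den \<sigma> A w =
     (hyp_real (A $ 2 $ 1) \<otimes>\<^bsub>hyp_ring \<sigma>\<^esub> w) \<oplus>\<^bsub>hyp_ring \<sigma>\<^esub> hyp_real (A $ 2 $ 2)"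

text \<open>
  The value is meaningful only if the denominator is a unit of the ring; dual and double numbers
  have nonzero non-units.
\<close>

definition moebius :: "real \<Rightarrow> real ^ 2 ^ 2 \<Rightarrow> hypercomplex \<Rightarrow> hypercomplex" where
  "moebius \<sigma> A w =
     moebius_num \<sigma> A w \<otimes>\<^bsub>hyp_ring \<sigma>\<^esub> inv\<^bsub>hyp_ring \<sigma>\<^esub> (moebius_den \<sigma> A w)"

definition SL2_map :: "real \<Rightarrow> real ^ 2 ^ 2 \<Rightarrow> real \<times> real \<Rightarrow> real \<times> real" where
  "SL2_map \<sigma> A = (\<lambda>(u, v).
     let a = A $ 1 $ 1; b = A $ 1 $ 2; c = A $ 2 $ 1; d = A $ 2 $ 2;
         q = (c * u + d)\<^sup>2 - \<sigma> * (c * v)\<^sup>2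
     in (((a * u + b) * (c * u + d) - \<sigma> * c * a * v\<^sup>2) / q, v / q))"

lemma cring_hyp_ring: "cring (hyp_ring \<sigma>)"
proof (rule cringI)
  show "abelian_group (hyp_ring \<sigma>)"
  proof (rule abelian_groupI)
    fix x :: hypercomplex
    show "\<exists>y\<in>carrier (hyp_ring \<sigma>). y \<oplus>\<^bsub>hyp_ring \<sigma>\<^esub> x = \<zero>\<^bsub>hyp_ring \<sigma>\<^esub>"
      by (intro bexI[of _ "Hyp (- hyp_re x) (- hyp_im x)"]) (simp_all add: hyp_ring_def)
  qed (simp_all add: hyp_ring_def)
  show "comm_monoid (hyp_ring \<sigma>)"
    by (rule comm_monoidI) (simp_all add: hyp_ring_def algebra_simps)
qed (simp add: hyp_ring_def algebra_simps)

lemma hyp_unit_square: "hyp_unit \<otimes>\<^bsub>hyp_ring \<sigma>\<^esub> hyp_unit = hyp_real \<sigma>"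
  by (simp add: hyp_ring_def hyp_unit_def hyp_real_def)

lemma hyp_of_pair_eq: "hyp_of_pair \<sigma> (u, v) = Hyp u v"
  by (simp add: hyp_of_pair_def hyp_ring_def hyp_unit_def hyp_real_def)

lemma bij_hyp_of_pair: "bij (hyp_of_pair \<sigma>)"
  by (rule bijI') (auto simp: hyp_of_pair_eq intro: hypercomplex.exhaust)

end

theory Submission
  imports Defs
begin

text \<open>
  The inverse of \<open>x + \<iota> y\<close> is its conjugate \<open>x - \<iota> y\<close> divided by the norm \<open>x\<^sup>2 - \<sigma> y\<^sup>2\<close>. Multiplying
  \<open>aw + b\<close> by the conjugate of \<open>cw + d\<close> gives the claimed first coordinate, and in the second one
  the coefficient of \<open>v\<close> is the determinant \<open>ad - bc = 1\<close>.
\<close>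

text \<open>The cross terms of an element times its conjugate cancel, leaving the norm. The
  hypothesis concerns the norm because for dual and double numbers it can vanish at nonzero
  elements.\<close>

lemma hyp_mult_conj:
  assumes "x\<^sup>2 - \<sigma> * y\<^sup>2 \<noteq> 0"
  shows "Hyp x y \<otimes>\<^bsub>hyp_ring \<sigma>\<^esub> Hyp (x / (x\<^sup>2 - \<sigma> * y\<^sup>2)) (- y / (x\<^sup>2 - \<sigma> * y\<^sup>2)) = \<one>\<^bsub>hyp_ring \<sigma>\<^esub>"
proof -
  define q where "q = x\<^sup>2 - \<sigma> * y\<^sup>2"
  have "x * (x / q) + \<sigma> * (y * (- y / q)) = (x\<^sup>2 - \<sigma> * y\<^sup>2) / q"
    by (simp add: power2_eq_square diff_divide_distrib)
  also have "\<dots> = 1"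
    using assms by (simp add: q_def)
  finally show ?thesis
    by (simp add: hyp_ring_def flip: q_def)
qed

text \<open>Commutativity turns the one-sided inverse of \<open>hyp_mult_conj\<close> into a
  two-sided one. Membership in \<open>Units\<close> matters in its own right, since
  \<open>inv\<close> is a definite description with no guaranteed meaning elsewhere.\<close>

lemma
  assumes "x\<^sup>2 - \<sigma> * y\<^sup>2 \<noteq> 0"
  shows hyp_Units: "Hyp x y \<in> Units (hyp_ring \<sigma>)"
    and hyp_inv: "inv\<^bsub>hyp_ring \<sigma>\<^esub> (Hyp x y) = Hyp (x / (x\<^sup>2 - \<sigma> * y\<^sup>2)) (- y / (x\<^sup>2 - \<sigma> * y\<^sup>2))"
proof -
  interpret cring "hyp_ring \<sigma>"
    by (rule cring_hyp_ring)
  have carrier: "z \<in> carrier (hyp_ring \<sigma>)" for z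
    by (simp add: hyp_ring_def)
  show "Hyp x y \<in> Units (hyp_ring \<sigma>)"
    unfolding Units_def using hyp_mult_conj[OF assms] carrier
    by (auto intro!: bexI[of _ "Hyp (x / (x\<^sup>2 - \<sigma> * y\<^sup>2)) (- y / (x\<^sup>2 - \<sigma> * y\<^sup>2))"]
        simp: m_comm[OF carrier carrier, of _ "Hyp x y"])
  show "inv\<^bsub>hyp_ring \<sigma>\<^esub> (Hyp x y) = Hyp (x / (x\<^sup>2 - \<sigma> * y\<^sup>2)) (- y / (x\<^sup>2 - \<sigma> * y\<^sup>2))"
    by (rule comm_inv_char[OF carrier carrier hyp_mult_conj[OF assms]])
qed

lemma moebius_num_Hyp: "moebius_num \<sigma> A (Hyp u v) = Hyp (A $ 1 $ 1 * u + A $ 1 $ 2) (A $ 1 $ 1 * v)"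
  by (simp add: moebius_num_def hyp_ring_def hyp_real_def)

lemma moebius_den_Hyp: "moebius_den \<sigma> A (Hyp u v) = Hyp (A $ 2 $ 1 * u + A $ 2 $ 2) (A $ 2 $ 1 * v)"
  by (simp add: moebius_den_def hyp_ring_def hyp_real_def)

theorem proposition2p3:
  fixes \<sigma> u v :: real and A :: "real ^ 2 ^ 2"
  assumes "\<sigma> \<in> {-1, 0, 1}"
    and "A \<in> SL2"
    and "v > 0"
    and "(A $ 2 $ 1 * u + A $ 2 $ 2)\<^sup>2 - \<sigma> * (A $ 2 $ 1 * v)\<^sup>2 \<noteq> 0"
  shows "moebius_den \<sigma> A (hyp_of_pair \<sigma> (u, v)) \<in> Units (hyp_ring \<sigma>) \<and>
         hyp_of_pair \<sigma> (SL2_map \<sigma> A (u, v)) = moebius \<sigma> A (hyp_of_pair \<sigma> (u, v))"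
proof
  define a b c d where "a = A $ 1 $ 1" and "b = A $ 1 $ 2" and "c = A $ 2 $ 1" and "d = A $ 2 $ 2"
  note entries = a_def[symmetric] b_def[symmetric] c_def[symmetric] d_def[symmetric]
  define q where "q = (c * u + d)\<^sup>2 - \<sigma> * (c * v)\<^sup>2"
  have q: "(c * u + d)\<^sup>2 - \<sigma> * (c * v)\<^sup>2 \<noteq> 0"
    using assms(4) by (simp add: entries)
  have det: "a * d - b * c = 1"
    using assms(2) by (simp add: SL2_def det_2 entries)
  \<comment> \<open>The coordinates of \<open>cw + d\<close> are \<open>c * u + d\<close> and
    \<open>c * v\<close>, so its norm is \<open>q\<close>.\<close>
  show "moebius_den \<sigma> A (hyp_of_pair \<sigma> (u, v)) \<in> Units (hyp_ring \<sigma>)"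
    using hyp_Units[OF q] by (simp add: hyp_of_pair_eq moebius_den_Hyp entries)
  \<comment> \<open>The right-hand sides of \<open>re\<close> and \<open>im\<close> have the shape
    that the ring multiplication produces, so both can be matched against the product below.\<close>
  have re: "((a * u + b) * (c * u + d) - \<sigma> * c * a * v\<^sup>2) / q
      = (a * u + b) * ((c * u + d) / q) + \<sigma> * ((a * v) * (- (c * v) / q))"
    by (simp add: diff_divide_distrib power2_eq_square)
  \<comment> \<open>The two terms in \<open>a * c * u * v\<close> cancel, and what remains is
    \<open>v\<close> times the determinant.\<close>
  have "(a * u + b) * (- (c * v) / q) + (a * v) * ((c * u + d) / q) = v * (a * d - b * c) / q"
    by (simp add: algebra_simps add_divide_distrib diff_divide_distrib)
  then have im: "v / q = (a * u + b) * (- (c * v) / q) + (a * v) * ((c * u + d) / q)"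
    by (simp add: det)
  have "moebius \<sigma> A (Hyp u v)
      = Hyp (a * u + b) (a * v) \<otimes>\<^bsub>hyp_ring \<sigma>\<^esub> Hyp ((c * u + d) / q) (- (c * v) / q)"
    unfolding moebius_def moebius_num_Hyp moebius_den_Hyp entries hyp_inv[OF q] q_def ..
  also have "\<dots> = Hyp (((a * u + b) * (c * u + d) - \<sigma> * c * a * v\<^sup>2) / q) (v / q)"
    unfolding re im by (simp add: hyp_ring_def)
  also have "\<dots> = hyp_of_pair \<sigma> (SL2_map \<sigma> A (u, v))"
    by (simp add: SL2_map_def Let_def hyp_of_pair_eq entries q_def)
  finally show "hyp_of_pair \<sigma> (SL2_map \<sigma> A (u, v)) = moebius \<sigma> A (hyp_of_pair \<sigma> (u, v))"
    by (simp add: hyp_of_pair_eq)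
qed

end
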